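(* Let $w_1,w_2,w_3$ be positive integers such that $r$ divides none of $w_1,w_2,w_3$. Then for every integer $n\ge 0$, as an identity of polynomials in $y$, $$\begin{aligned} &\sum_{k+l+m=n}\binom{n}{k,l,m}B_{k,\chi,\xi^{w_3}}(w_1y)\,B_{l,\chi,\xi^{w_1}}(w_2y)\,B_{m,\chi,\xi^{w_2}}(w_3y)\,w_3^{k}w_1^{l}w_2^{m}\\ &=\sum_{k+l+m=n}\binom{n}{k,l,m}B_{k,\chi,\xi^{w_2}}(w_1y)\,B_{l,\chi,\xi^{w_1}}(w_3y)\,B_{m,\chi,\xi^{w_3}}(w_2y)\,w_2^{k}w_1^{l}w_3^{m}. \end{aligned}$$
   Context: Let $p$ be a prime, $\mathbb{C}_p$ the completion of an algebraic closure of $\mathbb{Q}_p$, $d$ a positive integer, and $\chi$ a primitive Dirichlet character of conductor $d$, with values viewed in $\mathbb{C}_p$ via a fixed embedding $\overline{\mathbb{Q}}\to\mathbb{C}_p$ (as usual $\chi(a)=0$ if $\gcd(a,d)>1$; for $d=1$, $\chi\equiv 1$). Let $r$ be a positive integer with $\gcd(r,pd)=1$ and let $\xi\neq 1$ in $\mathbb{C}_p$ be an $r$-th root of unity. For a root of unity $\eta\in\mathbb{C}_p$, the generalized twisted Bernoulli polynomials $B_{n,\chi,\eta}(x)$ attached to $\chi$ and $\eta$ are defined by the power series identity $$\frac{t\,e^{xt}}{\eta^{d}e^{dt}-1}\sum_{a=0}^{d-1}\chi(a)\eta^{a}e^{at}=\sum_{n=0}^{\infty}B_{n,\chi,\eta}(x)\frac{t^{n}}{n!}.$$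 (The left side is a power series in $t$ with coefficients in $\mathbb{C}_p[x]$, for any $\eta$.) Sums over $k+l+m=n$ run over all nonnegative integers $k,l,m$ with $k+l+m=n$, and $\binom{n}{k,l,m}=\frac{n!}{k!\,l!\,m!}$. *)

theory Defs
  imports "HOL-Analysis.Abstract_Metric_Spaces" "HOL-Computational_Algebra.Computational_Algebra"
begin

section \<open>The field of p-adic complex numbers\<close>

definition padic_abs :: "nat \<Rightarrow> rat \<Rightarrow> real" where
  "padic_abs p q =
     (if q = 0 then 0
      else real p powi (int (multiplicity (int p) (snd (quotient_of q)))
                        - int (multiplicity (int p) (fst (quotient_of q)))))"

definition algebraic_over :: "'a::field set \<Rightarrow> 'a set" where
  "algebraic_over F = {x. \<exists>f. f \<noteq> 0 \<and> (\<forall>i. coeff f i \<in> F) \<and> poly f x = 0}"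

text \<open>
  The type \<open>'c\<close> with the absolute value \<open>v\<close> is the completion of an algebraic closure of the
  field of p-adic numbers. All three fields involved are located inside \<open>'c\<close>: as \<open>'c\<close> is
  complete, the completion \<open>Qp\<close> of the rationals is their closure in \<open>'c\<close>; the elements algebraic
  over \<open>Qp\<close> form the subfield \<open>Qp_bar\<close>, which has to be algebraically closed; and \<open>'c\<close> is complete
  with \<open>Qp_bar\<close> dense in it. These conditions determine \<open>('c, v)\<close> up to isometric isomorphism.
\<close>

locale padic_complex_field =
  fixes p :: nat and v :: "'c::field_char_0 \<Rightarrow> real"
  assumes prime_p: "prime p"
    and v_nonneg: "v x \<ge> 0"
    and v_eq_0_iff: "v x = 0 \<longleftrightarrow> x = 0"
    and v_mult: "v (x * y) = v x * v y"
    and v_ultrametric: "v (x + y) \<le> max (v x) (v y)"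
    and v_of_rat: "v (of_rat q) = padic_abs p q"
begin

lemma v_uminus: "v (- x) = v x"
proof -
  have "v (- 1) * v (- 1) = v (1 :: 'c)" using v_mult[of "- 1" "- 1"] by simp
  moreover have one: "v (1 :: 'c) = 1"
    using v_mult[of 1 1] v_eq_0_iff[of 1] by simp
  ultimately have "v (- 1 :: 'c) = 1"
    using v_nonneg[of "- 1"] by (metis abs_of_nonneg abs_square_eq_1 power2_eq_square)
  then show ?thesis using v_mult[of "- 1" x] by simp
qed

sublocale Metric_space UNIV "\<lambda>x y :: 'c. v (x - y)"
proof
  fix x y z :: 'c
  show "0 \<le> v (x - y)" by (rule v_nonneg)
  show "v (x - y) = v (y - x)" using v_uminus[of "x - y"] by simp
  show "v (x - y) = 0 \<longleftrightarrow> x = y" by (simp add: v_eq_0_iff)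
  show "v (x - z) \<le> v (x - y) + v (y - z)"
    using v_ultrametric[of "x - y" "y - z"] v_nonneg[of "x - y"] v_nonneg[of "y - z"] by simp
qed

definition Qp :: "'c set" where
  "Qp = mtopology closure_of range of_rat"

definition Qp_bar :: "'c set" where
  "Qp_bar = algebraic_over Qp"

end

locale padic_complex_numbers = padic_complex_field +
  assumes complete: "mcomplete"
    and Qp_bar_alg_closed:
      "\<And>f. degree f > 0 \<Longrightarrow> (\<And>i. coeff f i \<in> Qp_bar) \<Longrightarrow> \<exists>x\<in>Qp_bar. poly f x = 0"
    and Qp_bar_dense: "mtopology closure_of Qp_bar = UNIV"

text \<open>
  Embeddings of the field of algebraic numbers, regarded as a subfield of the complex numbers;
  values outside that subfield are irrelevant.
\<close>

definition algebraic_embedding :: "(complex \<Rightarrow> 'c::field) \<Rightarrow> bool" where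
  "algebraic_embedding \<iota> \<longleftrightarrow>
     \<iota> 1 = 1 \<and> inj_on \<iota> {z. algebraic z} \<and>
     (\<forall>x y. algebraic x \<longrightarrow> algebraic y \<longrightarrow>
        \<iota> (x + y) = \<iota> x + \<iota> y \<and> \<iota> (x * y) = \<iota> x * \<iota> y)"


section \<open>Dirichlet characters\<close>

definition dirichlet_character :: "nat \<Rightarrow> (int \<Rightarrow> complex) \<Rightarrow> bool" where
  "dirichlet_character d chi \<longleftrightarrow>
     d > 0 \<and> chi 1 = 1 \<and>
     (\<forall>a b. chi (a * b) = chi a * chi b) \<and>
     (\<forall>a. chi (a + int d) = chi a) \<and>
     (\<forall>a. chi a = 0 \<longleftrightarrow> \<not> coprime a (int d))"

text \<open>A character of modulus \<open>d\<close> is primitive, i.e. has conductor \<open>d\<close>, if it is not induced from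
  a character of a smaller modulus.\<close>

definition primitive_dirichlet_character :: "nat \<Rightarrow> (int \<Rightarrow> complex) \<Rightarrow> bool" where
  "primitive_dirichlet_character d chi \<longleftrightarrow>
     dirichlet_character d chi \<and>
     \<not> (\<exists>d' psi. d' dvd d \<and> d' < d \<and> dirichlet_character d' psi \<and>
               (\<forall>a. coprime a (int d) \<longrightarrow> chi a = psi a))"

lemma primitive_dirichlet_character_1_iff:
  "primitive_dirichlet_character 1 chi \<longleftrightarrow> chi = (\<lambda>_. 1)"
proof
  assume "primitive_dirichlet_character 1 chi"
  then have one: "chi 1 = 1" and per: "\<And>a. chi (a + 1) = chi a"
    by (auto simp: primitive_dirichlet_character_def dirichlet_character_def)
  have "chi a = 1" for a
  proof (induction a rule: int_induct[where k = 1])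
    case (step2 i)
    then show ?case using per[of "i - 1"] by simp
  qed (use one per in auto)
  then show "chi = (\<lambda>_. 1)" by auto
qed (auto simp: primitive_dirichlet_character_def dirichlet_character_def)


section \<open>Generalized twisted Bernoulli polynomials\<close>

definition fps_lift_poly :: "'a::zero fps \<Rightarrow> 'a poly fps" where
  "fps_lift_poly f = Abs_fps (\<lambda>n. [:fps_nth f n:])"

text \<open>The series \<open>exp (x t)\<close> in \<open>t\<close>, where \<open>x\<close> is the polynomial variable.\<close>

definition fps_exp_var :: "'a::field_char_0 poly fps" where
  "fps_exp_var = Abs_fps (\<lambda>n. monom (1 / fact n) n)"

definition twisted_num :: "nat \<Rightarrow> (int \<Rightarrow> 'a::field_char_0) \<Rightarrow> 'a \<Rightarrow> 'a fps" where
  "twisted_num d chi \<eta> =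
     fps_X * (\<Sum>a<d. fps_const (chi (int a) * \<eta> ^ a) * fps_exp (of_nat a))"

definition twisted_den :: "nat \<Rightarrow> 'a::field_char_0 \<Rightarrow> 'a fps" where
  "twisted_den d \<eta> = fps_const (\<eta> ^ d) * fps_exp (of_nat d) - 1"

text \<open>The division takes place in power series over the field. It is exact for \<open>d > 0\<close>,
  also when \<open>\<eta> ^ d = 1\<close>: then \<open>twisted_den d \<eta>\<close> has a simple zero at \<open>t = 0\<close>.\<close>

definition gen_twisted_bernoulli ::
    "nat \<Rightarrow> (int \<Rightarrow> 'a::field_char_0) \<Rightarrow> 'a \<Rightarrow> nat \<Rightarrow> 'a poly" where
  "gen_twisted_bernoulli d chi \<eta> n =
     smult (fact n)
       (fps_nth (fps_lift_poly (twisted_num d chi \<eta> / twisted_den d \<eta>) * fps_exp_var) n)"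

lemma twisted_den_nonzero:
  fixes \<eta> :: "'a::field_char_0"
  assumes "d > 0"
  shows "twisted_den d \<eta> \<noteq> 0" and "subdegree (twisted_den d \<eta>) \<le> 1"
proof -
  have "\<exists>i\<le>1. fps_nth (twisted_den d \<eta>) i \<noteq> 0"
  proof (cases "\<eta> = 0")
    case True
    with assms have "fps_nth (twisted_den d \<eta>) 0 \<noteq> 0" by (simp add: twisted_den_def zero_power)
    then show ?thesis by blast
  next
    case False
    with assms have "fps_nth (twisted_den d \<eta>) 1 \<noteq> 0" by (simp add: twisted_den_def)
    then show ?thesis by blast
  qed
  then obtain i where i: "i \<le> 1" "fps_nth (twisted_den d \<eta>) i \<noteq> 0" by blast
  then show "twisted_den d \<eta> \<noteq> 0" by auto
  show "subdegree (twisted_den d \<eta>) \<le> 1"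
    using subdegree_leI[OF i(2)] i(1) by linarith
qed

lemma twisted_den_dvd_num:
  fixes chi :: "int \<Rightarrow> 'a::field_char_0"
  assumes "d > 0"
  shows "twisted_den d \<eta> dvd twisted_num d chi \<eta>"
proof (cases "twisted_num d chi \<eta> = 0")
  case False
  then have "subdegree (twisted_num d chi \<eta>) \<ge> 1"
    unfolding twisted_num_def by (simp add: subdegree_mult)
  with False twisted_den_nonzero[OF assms, of \<eta>] show ?thesis
    by (simp add: fps_dvd_iff)
qed auto

lemma fps_lift_poly_mult:
  "fps_lift_poly (f * g) = fps_lift_poly f * fps_lift_poly (g :: 'a::comm_ring_1 fps)"
proof -
  have "[:\<Sum>i\<in>I. h i:] = (\<Sum>i\<in>I. [:h i:])" for h :: "nat \<Rightarrow> 'a" and I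
    by (simp add: poly_eq_iff coeff_sum coeff_pCons split: nat.split)
  then show ?thesis
    by (simp add: fps_eq_iff fps_lift_poly_def fps_mult_nth mult.commute)
qed

text \<open>The polynomials are characterized by their defining power series identity.\<close>

lemma gen_twisted_bernoulli_iff:
  fixes chi :: "int \<Rightarrow> 'a::field_char_0"
  assumes "d > 0"
  shows "B = gen_twisted_bernoulli d chi \<eta> \<longleftrightarrow>
         fps_lift_poly (twisted_den d \<eta>) * Abs_fps (\<lambda>n. smult (1 / fact n) (B n)) =
         fps_lift_poly (twisted_num d chi \<eta>) * fps_exp_var"
proof -
  let ?D = "fps_lift_poly (twisted_den d \<eta>)"
  let ?Q = "fps_lift_poly (twisted_num d chi \<eta> / twisted_den d \<eta>) * fps_exp_var"
  have "twisted_num d chi \<eta> = twisted_den d \<eta> * (twisted_num d chi \<eta> / twisted_den d \<eta>)"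
    using twisted_den_dvd_num[OF assms, of \<eta> chi] by simp
  then have num: "fps_lift_poly (twisted_num d chi \<eta>) * fps_exp_var = ?D * ?Q"
    by (metis fps_lift_poly_mult mult.assoc)
  have "?D \<noteq> 0"
    using twisted_den_nonzero(1)[OF assms, of \<eta>] by (auto simp: fps_eq_iff fps_lift_poly_def)
  then have "?D * Abs_fps (\<lambda>n. smult (1 / fact n) (B n)) = ?D * ?Q \<longleftrightarrow>
             Abs_fps (\<lambda>n. smult (1 / fact n) (B n)) = ?Q"
    by simp
  also have "\<dots> \<longleftrightarrow> (\<forall>n. smult (1 / fact n) (B n) = fps_nth ?Q n)"
    by (simp add: fps_eq_iff)
  also have "\<dots> \<longleftrightarrow> (\<forall>n. B n = smult (fact n) (fps_nth ?Q n))"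
  proof (intro all_cong1 iffI)
    fix n
    assume "smult (1 / fact n) (B n) = fps_nth ?Q n"
    then show "B n = smult (fact n) (fps_nth ?Q n)" 
      by (metis smult_smult fact_nonzero nonzero_mult_div_cancel_left times_divide_eq_right
          mult.right_neutral smult_1_left)
  next
    fix n
    assume "B n = smult (fact n) (fps_nth ?Q n)"
    then show "smult (1 / fact n) (B n) = fps_nth ?Q n" by simp
  qed
  also have "\<dots> \<longleftrightarrow> B = gen_twisted_bernoulli d chi \<eta>"
    by (auto simp: gen_twisted_bernoulli_def fun_eq_iff)
  finally show ?thesis by (simp add: num)
qed

end

theory Submission
  imports Defs
begin

text \<open>
  Write \<open>G\<^sub>\<eta>(t) = twisted_num d \<chi> \<eta> / twisted_den d \<eta>\<close>. The exponential generating function of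
  \<open>B\<^sub>k\<^sub>,\<^sub>\<chi>\<^sub>,\<^sub>\<eta>(w y) c\<^sup>k\<close> is \<open>G\<^sub>\<eta>(c t) exp(w c y t)\<close>. Hence both sides of the identity are
  \<open>n!\<close> times the \<open>n\<close>-th coefficient of
  \<open>G(t) exp((w\<^sub>1 w\<^sub>2 + w\<^sub>1 w\<^sub>3 + w\<^sub>2 w\<^sub>3) y t)\<close>, where \<open>G(t)\<close> is the product of the three series
  \<open>G\<^sub>\<eta>(w\<^sub>i t)\<close> with \<open>\<eta> = \<xi>\<close> to the power \<open>w\<^sub>i\<close>.
\<close>

lemma smult_sum_right: "smult c (\<Sum>i\<in>I. p i) = (\<Sum>i\<in>I. smult c (p i))"
  by (induction I rule: infinite_finite_induct) (auto simp: smult_add_right)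

text \<open>This is exp(c x t), where x is the polynomial variable; \<open>fps_exp_var\<close> is
  the case c = 1.\<close>

definition fps_exp_var_scaled :: "'a::field_char_0 \<Rightarrow> 'a poly fps" where
  "fps_exp_var_scaled c = Abs_fps (\<lambda>n. monom (c ^ n / fact n) n)"

lemma fps_exp_var_scaled_add:
  "fps_exp_var_scaled (a + b) = fps_exp_var_scaled a * fps_exp_var_scaled b"
proof (rule fps_ext)
  fix n
  \<comment> \<open>The binomial theorem divided by n!, read off as the coefficient of t^n in exp((a
    + b) t) = exp(a t) exp(b t).\<close>
  have "(a + b) ^ n / fact n = (\<Sum>i=0..n. a ^ i / fact i * (b ^ (n - i) / fact (n - i)))"
    using arg_cong[OF fps_exp_add_mult[of a b], of "\<lambda>f. fps_nth f n"]
    by (simp add: fps_mult_nth)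
  then have "monom ((a + b) ^ n / fact n) n =
      (\<Sum>i=0..n. monom (a ^ i / fact i * (b ^ (n - i) / fact (n - i))) n)"
    by (simp add: monom_sum)
  also have "\<dots> = (\<Sum>i=0..n. monom (a ^ i / fact i) i * monom (b ^ (n - i) / fact (n - i)) (n - i))"
    by (intro sum.cong) (auto simp: mult_monom)
  finally show "fps_nth (fps_exp_var_scaled (a + b)) n =
      fps_nth (fps_exp_var_scaled a * fps_exp_var_scaled b) n"
    by (simp add: fps_exp_var_scaled_def fps_mult_nth)
qed

text \<open>The substitution f(c t), given by its coefficients so that it can be matched termwise in
  Cauchy products.\<close>

definition fps_scale :: "'a::comm_semiring_1 \<Rightarrow> 'a fps \<Rightarrow> 'a fps" where
  "fps_scale c f = Abs_fps (\<lambda>n. c ^ n * fps_nth f n)"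

text \<open>Replacing t by c t and x by w x turns f(t) exp(x t) into f(c t) exp(w c x t). In each
  term of the Cauchy product, c^n splits into c^i for f and c^(n - i) for the exponential.\<close>

lemma smult_nth_lift_exp_var_pcompose:
  fixes f :: "'a::field_char_0 fps"
  shows "smult (c ^ n) (fps_nth (fps_lift_poly f * fps_exp_var) n \<circ>\<^sub>p [:0, w:]) =
    fps_nth (fps_lift_poly (fps_scale c f) * fps_exp_var_scaled (w * c)) n"
proof -
  have "smult (c ^ n) (([:fps_nth f i:] * monom (1 / fact (n - i)) (n - i)) \<circ>\<^sub>p [:0, w:]) =
      [:c ^ i * fps_nth f i:] * monom ((w * c) ^ (n - i) / fact (n - i)) (n - i)"
    if "i \<le> n" for i
  proof -
    \<comment> \<open>Polynomials over an infinite field are equal once they agree as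
      functions.\<close>
    have "monom a k \<circ>\<^sub>p [:0, w:] = monom (a * w ^ k) k" for a k
      by (simp add: fun_eq_iff poly_monom poly_pcompose power_mult_distrib mult_ac
          flip: poly_eq_poly_eq_iff)
    moreover have "c ^ n = c ^ i * c ^ (n - i)"
      using that by (simp flip: power_add)
    ultimately show ?thesis
      by (simp add: smult_monom power_mult_distrib pcompose_smult mult_ac)
  qed
  then show ?thesis
    by (simp add: fps_mult_nth fps_lift_poly_def fps_exp_var_def fps_scale_def
        fps_exp_var_scaled_def pcompose_sum smult_sum_right)
qed

lemma fps_nth_mult3:
  fixes f g h :: "'a::comm_ring_1 fps"
  shows "fps_nth (f * g * h) n =
    (\<Sum>(k, l, m) \<in> {(k, l, m). k + l + m = n}. fps_nth f k * fps_nth g l * fps_nth h m)"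
proof -
  have "fps_nth (f * g * h) n =
      (\<Sum>(i, k) \<in> (SIGMA i:{0..n}. {0..i}). fps_nth f k * fps_nth g (i - k) * fps_nth h (n - i))"
    by (simp add: fps_mult_nth sum_distrib_right sum.Sigma)
  also have "\<dots> =
      (\<Sum>(k, l, m) \<in> {(k, l, m). k + l + m = n}. fps_nth f k * fps_nth g l * fps_nth h m)"
    \<comment> \<open>The outer index of the nested Cauchy product is i = k + l, so l = i - k and m
      = n - i.\<close>
    by (rule sum.reindex_bij_witness[where i = "\<lambda>(k, l, m). (k + l, k)"
          and j = "\<lambda>(i, k). (k, i - k, n - i)"]) auto
  finally show ?thesis .
qed

text \<open>Arguments and scales are independent parameters, so that both sides of the final
  identity are instances. The arguments survive only in the exponent, because the three exponentials
  merge into one.\<close>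

lemma bernoulli_triple_sum:
  fixes chi :: "int \<Rightarrow> 'a::field_char_0" and d :: nat
    and a1 a2 a3 b1 b2 b3 :: 'a
  defines "G \<equiv> (\<lambda>c \<eta>. fps_lift_poly (fps_scale c (twisted_num d chi \<eta> / twisted_den d \<eta>)))"
  shows "(\<Sum>(k, l, m) \<in> {(k, l, m). k + l + m = n}.
      smult (fact n / (fact k * fact l * fact m) * b1 ^ k * b2 ^ l * b3 ^ m)
       ((gen_twisted_bernoulli d chi \<eta>1 k \<circ>\<^sub>p [:0, a1:]) *
        (gen_twisted_bernoulli d chi \<eta>2 l \<circ>\<^sub>p [:0, a2:]) *
        (gen_twisted_bernoulli d chi \<eta>3 m \<circ>\<^sub>p [:0, a3:]))) =
    smult (fact n) (fps_nth (G b1 \<eta>1 * G b2 \<eta>2 * G b3 \<eta>3 *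
      fps_exp_var_scaled (a1 * b1 + a2 * b2 + a3 * b3)) n)"
proof -
  define F where "F = (\<lambda>a b \<eta>. G b \<eta> * fps_exp_var_scaled (a * b))"
  have nth_F: "smult (b ^ k) (gen_twisted_bernoulli d chi \<eta> k \<circ>\<^sub>p [:0, a:]) =
      smult (fact k) (fps_nth (F a b \<eta>) k)" for a b \<eta> k
    unfolding F_def G_def smult_nth_lift_exp_var_pcompose[symmetric]
    by (simp add: gen_twisted_bernoulli_def pcompose_smult mult.commute)
  have "smult (fact n / (fact k * fact l * fact m) * b1 ^ k * b2 ^ l * b3 ^ m)
       ((gen_twisted_bernoulli d chi \<eta>1 k \<circ>\<^sub>p [:0, a1:]) *
        (gen_twisted_bernoulli d chi \<eta>2 l \<circ>\<^sub>p [:0, a2:]) *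
        (gen_twisted_bernoulli d chi \<eta>3 m \<circ>\<^sub>p [:0, a3:])) =
      smult (fact n) (fps_nth (F a1 b1 \<eta>1) k * fps_nth (F a2 b2 \<eta>2) l * fps_nth (F a3 b3 \<eta>3) m)"
    (is "?L = _") for k l m
  proof -
    have "?L = smult (fact n / (fact k * fact l * fact m))
       (smult (b1 ^ k) (gen_twisted_bernoulli d chi \<eta>1 k \<circ>\<^sub>p [:0, a1:]) *
        smult (b2 ^ l) (gen_twisted_bernoulli d chi \<eta>2 l \<circ>\<^sub>p [:0, a2:]) *
        smult (b3 ^ m) (gen_twisted_bernoulli d chi \<eta>3 m \<circ>\<^sub>p [:0, a3:]))"
      by (simp add: mult_ac)
    \<comment> \<open>By \<open>nth_F\<close> the three factors contribute k!, l! and m!, which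
      cancel the denominator of the multinomial coefficient.\<close>
    also have "\<dots> = smult (fact n)
        (fps_nth (F a1 b1 \<eta>1) k * fps_nth (F a2 b2 \<eta>2) l * fps_nth (F a3 b3 \<eta>3) m)"
      unfolding nth_F by (simp add: field_simps)
    finally show ?thesis .
  qed
  then have "(\<Sum>(k, l, m) \<in> {(k, l, m). k + l + m = n}.
      smult (fact n / (fact k * fact l * fact m) * b1 ^ k * b2 ^ l * b3 ^ m)
       ((gen_twisted_bernoulli d chi \<eta>1 k \<circ>\<^sub>p [:0, a1:]) *
        (gen_twisted_bernoulli d chi \<eta>2 l \<circ>\<^sub>p [:0, a2:]) *
        (gen_twisted_bernoulli d chi \<eta>3 m \<circ>\<^sub>p [:0, a3:]))) =
      smult (fact n) (fps_nth (F a1 b1 \<eta>1 * F a2 b2 \<eta>2 * F a3 b3 \<eta>3) n)"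
    by (simp add: fps_nth_mult3 smult_sum_right case_prod_unfold)
  also have "F a1 b1 \<eta>1 * F a2 b2 \<eta>2 * F a3 b3 \<eta>3 =
      G b1 \<eta>1 * G b2 \<eta>2 * G b3 \<eta>3 * fps_exp_var_scaled (a1 * b1 + a2 * b2 + a3 * b3)"
    by (simp add: F_def fps_exp_var_scaled_add mult_ac)
  finally show ?thesis .
qed

theorem theorem10:
  fixes p d r w1 w2 w3 n :: nat
    and v :: "'c::field_char_0 \<Rightarrow> real"
    and \<iota> :: "complex \<Rightarrow> 'c"
    and chi :: "int \<Rightarrow> complex"
    and \<xi> :: 'c
  assumes "prime p"
    and "padic_complex_numbers p v"
    and "algebraic_embedding \<iota>"
    and "d > 0"
    and "primitive_dirichlet_character d chi"
    and "r > 0"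
    and "coprime r (p * d)"
    and "\<xi> ^ r = 1"
    and "\<xi> \<noteq> 1"
    and "w1 > 0" and "w2 > 0" and "w3 > 0"
    and "\<not> r dvd w1" and "\<not> r dvd w2" and "\<not> r dvd w3"
  shows
    "(\<Sum>(k, l, m) \<in> {(k, l, m). k + l + m = n}.
        smult (fact n / (fact k * fact l * fact m) * of_nat w3 ^ k * of_nat w1 ^ l * of_nat w2 ^ m)
         ((gen_twisted_bernoulli d (\<lambda>a. \<iota> (chi a)) (\<xi> ^ w3) k \<circ>\<^sub>p [:0, of_nat w1:]) *
          (gen_twisted_bernoulli d (\<lambda>a. \<iota> (chi a)) (\<xi> ^ w1) l \<circ>\<^sub>p [:0, of_nat w2:]) *
          (gen_twisted_bernoulli d (\<lambda>a. \<iota> (chi a)) (\<xi> ^ w2) m \<circ>\<^sub>p [:0, of_nat w3:]))) =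
     (\<Sum>(k, l, m) \<in> {(k, l, m). k + l + m = n}.
        smult (fact n / (fact k * fact l * fact m) * of_nat w2 ^ k * of_nat w1 ^ l * of_nat w3 ^ m)
         ((gen_twisted_bernoulli d (\<lambda>a. \<iota> (chi a)) (\<xi> ^ w2) k \<circ>\<^sub>p [:0, of_nat w1:]) *
          (gen_twisted_bernoulli d (\<lambda>a. \<iota> (chi a)) (\<xi> ^ w1) l \<circ>\<^sub>p [:0, of_nat w3:]) *
          (gen_twisted_bernoulli d (\<lambda>a. \<iota> (chi a)) (\<xi> ^ w3) m \<circ>\<^sub>p [:0, of_nat w2:])))"
  \<comment> \<open>On both sides each scale w is paired with the twist \<xi>^w, and the products of
    argument and scale are the three pairwise products of w1, w2, w3. Only the order of factors and
    summands differs.\<close>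
  unfolding bernoulli_triple_sum by (simp only: mult_ac add_ac)

end
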